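(* Let $q$ be a prime power, let $f(X)=X^2+bX+c\in\mathbb F_q[X]$ be irreducible, and write $$\frac{X^{q+2}-cX}{f(X)}=h_1X^q+h_2X^{q-1}+\cdots+h_qX+h_{q+1}$$ (the quotient is a polynomial because $f(X)\mid X^{q+1}-c$). Let $\{U_i\}_{i\ge0}$ be the Lucas sequence of the first type associated to $f(X)$. Then $h_i=U_i$ for every $1\le i\le q+1$.
   Context: The Lucas sequence of the first type associated to $f(X)=X^2+bX+c$ is defined by $U_0=0$, $U_1=1$, and $U_n=-bU_{n-1}-cU_{n-2}$ for $n\ge2$ (elements of $\mathbb F_q$). *)

theory Defs
  imports
    "HOL-Computational_Algebra.Computational_Algebra"
    "HOL-Library.Cardinality"
begin

text \<open>Lucas sequence of the first type associated to \<open>X^2 + b X + c\<close>.\<close>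

fun lucas_U :: "'a::comm_ring_1 \<Rightarrow> 'a \<Rightarrow> nat \<Rightarrow> 'a" where
  "lucas_U b c 0 = 0"
| "lucas_U b c (Suc 0) = 1"
| "lucas_U b c (Suc (Suc n)) = - b * lucas_U b c (Suc n) - c * lucas_U b c n"

end

theory Submission imports Defs
begin

text \<open>
  Modulo the irreducible \<open>f\<close>, the Frobenius map fixes the coefficients of \<open>f\<close>, so \<open>X^q\<close> is a root
  of \<open>f\<close> and \<open>f\<close> divides \<open>(X^q - X) (X^q + X + b)\<close>. It does not divide \<open>X^q - X\<close>, which is a
  product of linear factors. Hence \<open>X^q = - X - b\<close> and \<open>X^(q+1) = c\<close> modulo \<open>f\<close>. The Lucas
  recurrence gives \<open>f (U_1 X^(n-1) + \<dots> + U_n) = X^(n+1) - U_(n+1) X + c U_n\<close>, and for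
  \<open>n = q + 1\<close> a comparison of the remainders modulo \<open>f\<close> shows that the right-hand side is
  \<open>X^(q+2) - c X\<close>.
\<close>

text \<open>The library version is stated for the class \<open>finite_field\<close>, which the sort
  \<open>{field, finite}\<close> does not entail.\<close>

lemma power_CARD_eq_same:
  fixes x :: "'a::{field, finite}"
  shows "x ^ CARD('a) = x"
proof (cases "x = 0")
  case True
  then show ?thesis by simp
next
  case False
  let ?P = "\<Prod>y\<in>UNIV - {0 :: 'a}. y"
  have "bij_betw ((*) x) (UNIV - {0}) (UNIV - {0})"
    by (rule bij_betw_byWitness[where f' = "\<lambda>y. y / x"]) (use False in auto)
  then have "(\<Prod>y\<in>UNIV - {0}. x * y) = ?P"
    by (rule prod.reindex_bij_betw)
  then have "x ^ card (UNIV - {0 :: 'a}) * ?P = ?P"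
    by (simp add: prod.distrib)
  moreover have "?P \<noteq> 0"
    by simp
  ultimately have "x ^ (CARD('a) - 1) = 1"
    by (simp add: card_Diff_singleton)
  then have "x ^ Suc (CARD('a) - 1) = x"
    by (simp only: power_Suc mult_1_right)
  moreover have "Suc (CARD('a) - 1) = CARD('a)"
    using finite_UNIV_card_ge_0[where 'a = 'a] by simp
  ultimately show ?thesis
    by (simp only:)
qed

text \<open>Evaluation at all field elements shows \<open>(X + 1)^q = X^q + 1\<close>; comparing coefficients gives
  the claim without knowing that \<open>q\<close> is a power of the characteristic.\<close>

lemma of_nat_CARD_choose_eq_0:
  assumes "0 < k" "k < CARD('a::{field, finite})"
  shows "of_nat (CARD('a) choose k) = (0 :: 'a)"
proof -
  let ?q = "CARD('a)"
  have "[:1, 1 :: 'a:] ^ ?q = monom 1 ?q + 1"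
  \<comment> \<open>The q evaluation points only determine a polynomial of degree below q; equality
    of the coefficients of X^q lowers the degree of the difference below q.\<close>
  proof (rule poly_eqI_degree_lead_coeff[where A = UNIV and n = ?q])
    show "coeff ([:1, 1 :: 'a:] ^ ?q) ?q = coeff (monom 1 ?q + 1) ?q"
      by (simp add: coeff_linear_poly_power)
    show "degree ([:1, 1 :: 'a:] ^ ?q) \<le> ?q"
      by (simp add: degree_linear_power)
    show "degree (monom 1 ?q + 1 :: 'a poly) \<le> ?q"
      by (intro degree_add_le degree_monom_le) simp
  qed (simp_all add: poly_monom power_CARD_eq_same)
  then have "coeff ([:1, 1 :: 'a:] ^ ?q) k = coeff (monom 1 ?q + 1) k"
    by simp
  then show ?thesis
    using assms by (simp add: coeff_linear_poly_power)
qed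

lemma add_power_CARD_poly:
  fixes r s :: "'a::{field, finite} poly"
  shows "(r + s) ^ CARD('a) = r ^ CARD('a) + s ^ CARD('a)"
proof -
  let ?q = "CARD('a)"
  have "(r + s) ^ ?q = (\<Sum>k\<le>?q. of_nat (?q choose k) * r ^ k * s ^ (?q - k))"
    by (rule binomial_ring)
  also have "\<dots> = (\<Sum>k\<in>{0, ?q}. of_nat (?q choose k) * r ^ k * s ^ (?q - k))"
    by (rule sum.mono_neutral_right)
      (auto simp: of_nat_poly of_nat_CARD_choose_eq_0)
  also have "\<dots> = r ^ ?q + s ^ ?q"
    by (simp add: add.commute)
  finally show ?thesis .
qed

text \<open>Both sides are monic of degree q, so their difference has degree below q, yet it
  vanishes at all q field elements.\<close>

lemma monom_CARD_minus_X_eq_prod: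
  "monom 1 (CARD('a)) - monom 1 1 = (\<Prod>a\<in>UNIV. [:- a, 1 :: 'a::{field, finite}:])"
proof (rule poly_eqI_degree_lead_coeff[where A = UNIV and n = "CARD('a)"])
  let ?q = "CARD('a)" and ?P = "\<Prod>a\<in>UNIV. [:- a, 1 :: 'a:]"
  have q: "?q > 1"
    using card_mono[of UNIV "{0, 1 :: 'a}"] by simp
  have deg: "degree ?P = ?q"
    by (subst degree_prod_sum_eq) auto
  have "lead_coeff ?P = 1"
    by (simp add: lead_coeff_prod)
  then show "coeff (monom 1 ?q - monom 1 1) ?q = coeff ?P ?q"
    using q by (simp add: deg)
  show "degree ?P \<le> ?q"
    by (simp add: deg)
  show "degree (monom 1 ?q - monom 1 1 :: 'a poly) \<le> ?q"
    using q by (intro degree_diff_le) (simp_all add: degree_monom_eq)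
  show "poly (monom 1 ?q - monom 1 1) z = poly ?P z" for z :: 'a
    by (simp add: poly_monom power_CARD_eq_same poly_prod)
qed simp

lemma irreducible_quadratic_dvd_monom_CARD:
  fixes b c :: "'a::{field, finite}"
  assumes irred: "irreducible [:c, b, 1:]"
  shows "[:c, b, 1:] dvd monom 1 (CARD('a) + 1) - [:c:]"
proof -
  define f where "f = [:c, b, 1:]"
  define X where "X = monom (1 :: 'a) 1"
  let ?q = "CARD('a)"
  have f_eq: "f = X ^ 2 + [:b:] * X + [:c:]"
    by (simp add: f_def X_def monom_altdef power2_eq_square)
  have prime: "prime_elem f"
    using irred unfolding f_def by (rule field_poly_irreducible_imp_prime)
  \<comment> \<open>This is f(X)^q = f(X^q): the q-th power is additive and fixes \<open>b\<close>
    and \<open>c\<close>.\<close>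
  have "f ^ ?q = (X ^ ?q) ^ 2 + [:b:] * X ^ ?q + [:c:]"
    by (simp add: f_eq add_power_CARD_poly smult_power poly_const_pow power_CARD_eq_same
        mult.commute flip: power_mult)
  \<comment> \<open>With Y = X^q this is the factorization f(Y) - f(X) = (Y - X) (Y + X +
    b).\<close>
  also have "\<dots> = f + (X ^ ?q - X) * (X ^ ?q + X + [:b:])"
    unfolding f_eq by algebra
  finally have "f dvd f + (X ^ ?q - X) * (X ^ ?q + X + [:b:])"
    by (metis dvd_power finite_UNIV_card_ge_0 finite_class.finite_UNIV)
  then have "f dvd (X ^ ?q - X) * (X ^ ?q + X + [:b:])"
    by simp
  moreover have "\<not> f dvd X ^ ?q - X"
  proof
    assume "f dvd X ^ ?q - X"
    then have "f dvd (\<Prod>a\<in>UNIV. [:- a, 1 :: 'a:])"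
      by (simp add: X_def monom_power flip: monom_CARD_minus_X_eq_prod)
    then obtain a where "f dvd [:- a, 1 :: 'a:]"
      using prime by (auto simp: prod_unfold_prod_mset elim!: prime_elem_dvd_prod_msetE)
    then have "degree f \<le> degree [:- a, 1:]"
      by (rule dvd_imp_degree_le) simp
    then show False
      by (simp add: f_def)
  qed
  ultimately have "f dvd X ^ ?q + X + [:b:]"
    using prime by (simp add: prime_elem_dvd_mult_iff)
  then have "f dvd X * (X ^ ?q + X + [:b:]) - f"
    by (intro dvd_diff dvd_mult) auto
  also have "X * (X ^ ?q + X + [:b:]) - f = X ^ (?q + 1) - [:c:]"
    by (simp add: f_eq algebra_simps power2_eq_square)
  finally show ?thesis
    by (simp add: f_def X_def monom_power mult_monom)
qed

text \<open>Induction in Horner form: the next sum is X times the old one plus U_(n+1). After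
  multiplication by f the X^2 terms cancel, and the new coefficient c U_n + b U_(n+1) of X is
  -U_(n+2).\<close>

lemma quadratic_mult_sum_lucas_U:
  fixes b c :: "'a::comm_ring_1"
  shows "[:c, b, 1:] * (\<Sum>i = 1..n. monom (lucas_U b c i) (n - i))
    = monom 1 (n + 1) - monom (lucas_U b c (n + 1)) 1 + [:c * lucas_U b c n:]"
proof (induction n)
  case 0
  then show ?case by simp
next
  case (Suc n)
  let ?S = "\<lambda>n. \<Sum>i = 1..n. monom (lucas_U b c i) (n - i)"
  have "?S (Suc n) = monom 1 1 * ?S n + [:lucas_U b c (Suc n):]"
    by (simp add: sum_distrib_left mult_monom monom_0 Suc_diff_le)
  then have "[:c, b, 1:] * ?S (Suc n)
      = monom 1 1 * ([:c, b, 1:] * ?S n) + [:c, b, 1:] * [:lucas_U b c (Suc n):]"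
    by (simp only: distrib_left mult.left_commute)
  also have "\<dots> = monom 1 (Suc n + 1) - monom (lucas_U b c (Suc n + 1)) 1
      + [:c * lucas_U b c (Suc n):]"
    unfolding Suc.IH by (simp add: monom_altdef algebra_simps)
  finally show ?case .
qed

text \<open>The exponents n - i are distinct for i \<le> n, so the sum determines its coefficients
  \<open>h\<close>; this gives uniqueness in the theorem.\<close>

lemma coeff_sum_monom_rev:
  assumes "1 \<le> j" "j \<le> n"
  shows "coeff (\<Sum>i = 1..n. monom (h i) (n - i)) (n - j) = h j"
proof -
  have "coeff (\<Sum>i = 1..n. monom (h i) (n - i)) (n - j) = (\<Sum>i = 1..n. if i = j then h i else 0)"
    unfolding coeff_sum by (rule sum.cong) (use assms in auto)
  then show ?thesis
    using assms by simp
qed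

theorem lemma6p2:
  fixes b c :: "'a::{field, finite}" and f :: "'a poly" and q :: nat
  assumes q: "q = CARD('a)"
    and f: "f = [:c, b, 1:]"
    and irred: "irreducible f"
  shows "f dvd monom 1 (q + 1) - [:c:]
    \<and> f dvd monom 1 (q + 2) - monom c 1
    \<and> (\<exists>h :: nat \<Rightarrow> 'a. (monom 1 (q + 2) - monom c 1) div f
          = (\<Sum>i = 1..q + 1. monom (h i) (q + 1 - i)))
    \<and> (\<forall>h :: nat \<Rightarrow> 'a. (monom 1 (q + 2) - monom c 1) div f
          = (\<Sum>i = 1..q + 1. monom (h i) (q + 1 - i))
        \<longrightarrow> (\<forall>i. 1 \<le> i \<and> i \<le> q + 1 \<longrightarrow> h i = lucas_U b c i))"
proof -
  let ?U = "lucas_U b c"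
  let ?S = "\<Sum>i = 1..q + 1. monom (?U i) (q + 1 - i)"
  \<comment> \<open>The discrepancy between f times \<open>?S\<close> and X^(q+2) - c X; being
    divisible by f and of degree below 2, it must vanish.\<close>
  let ?r = "[:c * ?U (q + 1), c - ?U (q + 2):]"
  have dvd1: "f dvd monom 1 (q + 1) - [:c:]"
    using irreducible_quadratic_dvd_monom_CARD irred unfolding f q by blast
  have "monom 1 (q + 2) - monom c 1 = monom 1 1 * (monom 1 (q + 1) - [:c:])"
    by (simp add: right_diff_distrib mult_monom flip: monom_0)
  then have dvd2: "f dvd monom 1 (q + 2) - monom c 1"
    using dvd1 by simp
  have S: "f * ?S = monom 1 (q + 2) - monom c 1 + ?r"
    unfolding f quadratic_mult_sum_lucas_U by (simp add: monom_altdef algebra_simps)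
  then have "f dvd monom 1 (q + 2) - monom c 1 + ?r"
    by (metis dvd_triv_left)
  then have "f dvd ?r"
    using dvd2 by (simp only: dvd_add_right_iff)
  moreover have "degree ?r < degree f"
    by (simp add: f)
  ultimately have "?r = 0"
    using dvd_imp_degree_le linorder_not_le by blast
  then have "f * ?S = monom 1 (q + 2) - monom c 1"
    using S by simp
  moreover have "f \<noteq> 0"
    by (simp add: f)
  ultimately have quot: "(monom 1 (q + 2) - monom c 1) div f = ?S"
    by (metis nonzero_mult_div_cancel_left)
  have "h i = ?U i"
    if "?S = (\<Sum>i = 1..q + 1. monom (h i) (q + 1 - i))" "1 \<le> i" "i \<le> q + 1" for h i
    using that by (metis coeff_sum_monom_rev)
  then show ?thesis
    using dvd1 dvd2 unfolding quot by blast
qed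

end
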